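(* Let $F\in\{S,Q,R,T\}$, let $G$ be any simple graph and let $H$ be any dispersable bipartite graph. Then $\operatorname{mbt}(G+_F H)\le \operatorname{mbt}(F(G))+\Delta(H)$, where $\Delta(H)$ is the maximum degree of $H$.
   Context: Matching book embedding: the vertices are placed in a linear order along a spine and each edge is assigned to a page (half-plane bounded by the spine) so that no two edges on the same page cross and every vertex is incident with at most one edge on each page. $\operatorname{mbt}(G)$ is the minimum number of pages of a matching book embedding of $G$. $G$ is dispersable if $\operatorname{mbt}(G)=\Delta(G)$. For a graph $G$: $S(G)$ is obtained by inserting a new vertex into each edge of $G$, so each edge becomes a path of length 2. $R(G)$ is obtained from $G$ by adding, for each edge $uv$, a new vertex adjacent to both $u$ and $v$; the original edges are kept. $Q(G)$ is obtained by inserting a new vertex into each edge of $G$ and then joining two new vertices whenever their edges of $G$ share an endpoint. $T(G)$ has vertex set $V(G)\cup E(G)$; two elements are adjacent if they are adjacent vertices of $G$, adjacent edges of $G$ (sharing an endpoint), or a vertex and an edge incident with it. In each case $V(F(G))=V(G)\cup E(G)$, where each edge of $G$ is identified with its new vertex. The $F$-sum $G+_F H$ has vertex set $(V(G)\cup E(G))\times V(H)$. Two vertices $(u_1,u_2)$ and $(v_1,v_2)$ are adjacent if and only if either $u_1=v_1\in V(G)$ and $u_2v_2\in E(H)$, or $u_2=v_2$ and $u_1v_1\in E(F(G))$. *)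

theory Defs
  imports Main
begin

record 'a sgraph =
  verts :: "'a set"
  edges :: "'a set set"

definition simple_graph :: "'a sgraph \<Rightarrow> bool" where
  "simple_graph G \<longleftrightarrow> finite (verts G) \<and> (\<forall>e\<in>edges G. e \<subseteq> verts G \<and> card e = 2)"

definition degree :: "'a sgraph \<Rightarrow> 'a \<Rightarrow> nat" where
  "degree G v = card {e \<in> edges G. v \<in> e}"

text \<open>Inserting 0 only matters for the graph without vertices, whose maximum degree is 0.\<close>
definition max_degree :: "'a sgraph \<Rightarrow> nat" where
  "max_degree G = Max (insert 0 (degree G ` verts G))"

definition bipartite :: "'a sgraph \<Rightarrow> bool" where
  "bipartite G \<longleftrightarrow> (\<exists>A B. A \<union> B = verts G \<and> A \<inter> B = {} \<and>
     (\<forall>e\<in>edges G. \<exists>a\<in>A. \<exists>b\<in>B. e = {a, b}))"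

text \<open>
  The spine is a linear order on the vertices, in Isabelle a reflexive relation; \<open>spine_less\<close> is
  its strict part. Two edges drawn in the same half-plane cross iff their endpoints strictly
  alternate along the spine.
\<close>
definition spine_less :: "'a rel \<Rightarrow> 'a \<Rightarrow> 'a \<Rightarrow> bool" where
  "spine_less r x y \<longleftrightarrow> (x, y) \<in> r \<and> x \<noteq> y"

definition crossing :: "'a rel \<Rightarrow> 'a set \<Rightarrow> 'a set \<Rightarrow> bool" where
  "crossing r e f \<longleftrightarrow> (\<exists>a b c d.
     spine_less r a b \<and> spine_less r b c \<and> spine_less r c d \<and>
     (e = {a, c} \<and> f = {b, d} \<or> f = {a, c} \<and> e = {b, d}))"

definition matching_book_embedding ::
    "'a sgraph \<Rightarrow> nat \<Rightarrow> 'a rel \<Rightarrow> ('a set \<Rightarrow> nat) \<Rightarrow> bool" where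
  "matching_book_embedding G n r page \<longleftrightarrow>
     linear_order_on (verts G) r \<and>
     (\<forall>e\<in>edges G. page e < n) \<and>
     (\<forall>e\<in>edges G. \<forall>f\<in>edges G. page e = page f \<longrightarrow> \<not> crossing r e f) \<and>
     (\<forall>v\<in>verts G. \<forall>i<n. card {e \<in> edges G. v \<in> e \<and> page e = i} \<le> 1)"

definition mbt :: "'a sgraph \<Rightarrow> nat" where
  "mbt G = (LEAST n. \<exists>r page. matching_book_embedding G n r page)"

definition dispersable :: "'a sgraph \<Rightarrow> bool" where
  "dispersable G \<longleftrightarrow> mbt G = max_degree G"

text \<open>
  The disjoint union of vertices and edges of \<open>G\<close> is a sum type: \<open>Inl v\<close> is the original
  vertex \<open>v\<close>, \<open>Inr e\<close> is the new vertex belonging to the edge \<open>e\<close>.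
\<close>
definition orig_edges :: "'a sgraph \<Rightarrow> ('a + 'a set) set set" where
  "orig_edges G = {{Inl u, Inl v} | u v. {u, v} \<in> edges G}"

definition incidence_edges :: "'a sgraph \<Rightarrow> ('a + 'a set) set set" where
  "incidence_edges G = {{Inl v, Inr e} | v e. e \<in> edges G \<and> v \<in> e}"

definition line_edges :: "'a sgraph \<Rightarrow> ('a + 'a set) set set" where
  "line_edges G =
     {{Inr e, Inr f} | e f. e \<in> edges G \<and> f \<in> edges G \<and> e \<noteq> f \<and> e \<inter> f \<noteq> {}}"

definition S_graph :: "'a sgraph \<Rightarrow> ('a + 'a set) sgraph" where
  "S_graph G = \<lparr>verts = verts G <+> edges G, edges = incidence_edges G\<rparr>"

definition R_graph :: "'a sgraph \<Rightarrow> ('a + 'a set) sgraph" where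
  "R_graph G = \<lparr>verts = verts G <+> edges G, edges = orig_edges G \<union> incidence_edges G\<rparr>"

definition Q_graph :: "'a sgraph \<Rightarrow> ('a + 'a set) sgraph" where
  "Q_graph G = \<lparr>verts = verts G <+> edges G, edges = incidence_edges G \<union> line_edges G\<rparr>"

definition T_graph :: "'a sgraph \<Rightarrow> ('a + 'a set) sgraph" where
  "T_graph G =
     \<lparr>verts = verts G <+> edges G, edges = orig_edges G \<union> line_edges G \<union> incidence_edges G\<rparr>"

definition F_sum ::
    "('a sgraph \<Rightarrow> ('a + 'a set) sgraph) \<Rightarrow> 'a sgraph \<Rightarrow> 'b sgraph \<Rightarrow>
     (('a + 'a set) \<times> 'b) sgraph" where
  "F_sum F G H =
     \<lparr>verts = (verts G <+> edges G) \<times> verts H,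
      edges = {{(Inl u, h), (Inl u, k)} | u h k. u \<in> verts G \<and> {h, k} \<in> edges H} \<union>
              {{(x, h), (y, h)} | x y h. h \<in> verts H \<and> {x, y} \<in> edges (F G)}\<rparr>"

text \<open>
  Every finite simple graph has a matching book embedding, and all constructions above stay
  within finite simple graphs, so the minimum in \<open>mbt\<close> is attained wherever it is used.
\<close>
lemma matching_book_embedding_exists:
  assumes "simple_graph G"
  shows "\<exists>n r page. matching_book_embedding G n r page"
proof -
  have "edges G \<subseteq> Pow (verts G)" and "finite (verts G)"
    using assms by (auto simp: simple_graph_def)
  then have fin: "finite (edges G)"
    by (meson finite_Pow_iff finite_subset)
  obtain page :: "'a set \<Rightarrow> nat" and n
    where pg: "page ` edges G = {i. i < n}" "inj_on page (edges G)"
    using finite_imp_inj_to_nat_seg[OF fin] by blast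
  obtain r where "well_order_on (verts G) r"
    using well_order_on by blast
  then have r: "linear_order_on (verts G) r"
    by (simp add: well_order_on_def)
  have "\<not> crossing r e e" for e
    by (auto simp: crossing_def spine_less_def doubleton_eq_iff)
  moreover have "card {e \<in> edges G. v \<in> e \<and> page e = i} \<le> 1" for v i
    by (rule card_le_Suc0_iff_eq[THEN iffD2, folded One_nat_def])
       (use fin pg in \<open>auto dest: inj_onD\<close>)
  ultimately have "matching_book_embedding G n r page"
    using r pg by (auto simp: matching_book_embedding_def dest: inj_onD)
  then show ?thesis by blast
qed

lemma simple_graph_F:
  assumes "simple_graph G" and "F \<in> {S_graph, Q_graph, R_graph, T_graph}"
  shows "simple_graph (F G)"
proof -
  have "edges G \<subseteq> Pow (verts G)" and fV: "finite (verts G)"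
    using assms by (auto simp: simple_graph_def)
  then have fE: "finite (edges G)"
    by (meson finite_Pow_iff finite_subset)
  have "e \<subseteq> verts G <+> edges G \<and> card e = 2"
    if e: "e \<in> orig_edges G \<union> line_edges G \<union> incidence_edges G" for e
  proof -
    from e consider
      (orig) u v where "e = {Inl u, Inl v}" "{u, v} \<in> edges G"
    | (line) f g where "e = {Inr f, Inr g}" "f \<in> edges G" "g \<in> edges G" "f \<noteq> g"
    | (inc) v f where "e = {Inl v, Inr f}" "f \<in> edges G" "v \<in> f"
      unfolding orig_edges_def line_edges_def incidence_edges_def by blast
    then show ?thesis
    proof cases
      case orig
      then have "{u, v} \<subseteq> verts G" "card {u, v} = 2"
        using assms(1) unfolding simple_graph_def by blast+
      then show ?thesis using orig by (auto simp: card_insert_if split: if_splits)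
    next
      case line
      then show ?thesis by auto
    next
      case inc
      then have "v \<in> verts G"
        using assms(1) unfolding simple_graph_def by blast
      then show ?thesis using inc by auto
    qed
  qed
  moreover have "verts (F G) = verts G <+> edges G"
    and "edges (F G) \<subseteq> orig_edges G \<union> line_edges G \<union> incidence_edges G"
    using assms(2) by (auto simp: S_graph_def Q_graph_def R_graph_def T_graph_def)
  ultimately show ?thesis
    using fV fE unfolding simple_graph_def by (simp, blast)
qed

lemma simple_graph_F_sum:
  assumes "simple_graph G" and "simple_graph H"
    and "F \<in> {S_graph, Q_graph, R_graph, T_graph}"
  shows "simple_graph (F_sum F G H)"
proof -
  have FG: "simple_graph (F G)" and V: "verts (F G) = verts G <+> edges G"
    using simple_graph_F[OF assms(1,3)] assms(3)
    by (auto simp: S_graph_def Q_graph_def R_graph_def T_graph_def)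
  have "e \<subseteq> verts (F G) \<times> verts H \<and> card e = 2" if e: "e \<in> edges (F_sum F G H)" for e
  proof -
    from e consider
      (H) u h k where "e = {(Inl u, h), (Inl u, k)}" "u \<in> verts G" "{h, k} \<in> edges H"
    | (F) x y h where "e = {(x, h), (y, h)}" "h \<in> verts H" "{x, y} \<in> edges (F G)"
      by (auto simp: F_sum_def)
    then show ?thesis
    proof cases
      case H
      then have "{h, k} \<subseteq> verts H" "card {h, k} = 2"
        using assms(2) unfolding simple_graph_def by blast+
      then show ?thesis using H V by (auto simp: card_insert_if split: if_splits)
    next
      case F
      then have "{x, y} \<subseteq> verts (F G)" "card {x, y} = 2"
        using FG unfolding simple_graph_def by blast+
      then show ?thesis using F by (auto simp: card_insert_if split: if_splits)
    qed
  qed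
  moreover have "finite (verts (F G) \<times> verts H)"
    using FG assms(2) by (simp add: simple_graph_def)
  ultimately show ?thesis
    by (simp add: simple_graph_def F_sum_def V)
qed

end

theory Submission
  imports Defs
begin

text \<open>
  Let \<open>A\<close>, \<open>B\<close> be the colour classes of \<open>H\<close>. Replace every vertex \<open>h\<close> on an optimal spine of \<open>H\<close>
  by a copy of an optimal spine of \<open>F(G)\<close>, reversed if \<open>h \<in> B\<close>. The copies of \<open>F(G)\<close> occupy disjoint
  intervals, so they share \<open>mbt (F G)\<close> pages. The copies of an edge of \<open>H\<close> join two mutually reversed
  intervals, so they are nested and fit on one page; hence the pages of \<open>H\<close> suffice for the rest.
  The argument works for the whole Cartesian product of \<open>F(G)\<close> and \<open>H\<close>, which contains the \<open>F\<close>-sum.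
\<close>

section \<open>The product graph, its spine and its pages\<close>

definition box_product :: "'a sgraph \<Rightarrow> 'b sgraph \<Rightarrow> ('a \<times> 'b) sgraph" where
  "box_product K H =
     \<lparr>verts = verts K \<times> verts H,
      edges = {E \<times> {h} | E h. E \<in> edges K \<and> h \<in> verts H} \<union>
              {{u} \<times> E | u E. u \<in> verts K \<and> E \<in> edges H}\<rparr>"

text \<open>Lexicographic, with the second coordinate dominant and \<open>r\<close> reversed on the
  layers outside \<open>A\<close>. The carriers are explicit because for \<open>h \<noteq> k\<close>
  nothing else confines the first coordinates to \<open>V\<close>, whereas
  \<open>linear_order_on\<close> requires a relation inside \<open>V \<times> W\<close>.\<close>

definition alternating_order :: "'a set \<Rightarrow> 'a rel \<Rightarrow> 'b set \<Rightarrow> 'b set \<Rightarrow> 'b rel \<Rightarrow> ('a \<times> 'b) rel" where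
  "alternating_order V r A W s =
     {((x, h), (y, k)). x \<in> V \<and> y \<in> V \<and> h \<in> W \<and> k \<in> W \<and>
        (spine_less s h k \<or> h = k \<and> (if h \<in> A then (x, y) \<in> r else (y, x) \<in> r))}"

text \<open>An edge of the product is merely a set of pairs, so its origin is read off its second
  projection: a singleton for a copy of an edge of the first factor, a two-element set for a copy of
  an edge of the second. The shift by \<open>n\<close> keeps the two page ranges apart.\<close>

definition product_page ::
    "nat \<Rightarrow> ('a set \<Rightarrow> nat) \<Rightarrow> ('b set \<Rightarrow> nat) \<Rightarrow> ('a \<times> 'b) set \<Rightarrow> nat" where
  "product_page n p q e = (if card (snd ` e) = 1 then p (fst ` e) else n + q (snd ` e))"

section \<open>Linear orders and the alternating spine\<close>

lemma simple_graph_finite_edges: "simple_graph G \<Longrightarrow> finite (edges G)"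
  by (rule finite_subset[of _ "Pow (verts G)"]) (auto simp: simple_graph_def)

lemma spine_less_trans:
  "\<lbrakk>linear_order_on V r; spine_less r x y; spine_less r y z\<rbrakk> \<Longrightarrow> spine_less r x z"
  by (auto simp: spine_less_def order_on_defs dest: transD antisymD)

lemma spine_less_asym: "\<lbrakk>linear_order_on V r; spine_less r x y\<rbrakk> \<Longrightarrow> \<not> spine_less r y x"
  by (auto simp: spine_less_def order_on_defs dest: antisymD)

lemma linear_order_alternating_order:
  assumes r: "linear_order_on V r" and s: "linear_order_on W s"
  shows "linear_order_on (V \<times> W) (alternating_order V r A W s)" (is "linear_order_on _ ?R")
proof -
  have tr: "trans r" "antisym r" "\<And>x. x \<in> V \<Longrightarrow> (x, x) \<in> r" "total_on V r"
    using r by (auto simp: order_on_defs refl_on_def)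
  have ts: "total_on W s"
    using s by (auto simp: order_on_defs)
  have "trans ?R"
  proof (rule transI)
    fix a b c assume "(a, b) \<in> ?R" "(b, c) \<in> ?R"
    then show "(a, c) \<in> ?R"
      using tr(1) spine_less_trans[OF s]
      by (auto simp: alternating_order_def dest: transD split: if_splits)
  qed
  moreover have "antisym ?R"
  proof (rule antisymI)
    fix a b assume "(a, b) \<in> ?R" "(b, a) \<in> ?R"
    then show "a = b"
      using tr(2) spine_less_asym[OF s]
      by (auto simp: alternating_order_def spine_less_def dest: antisymD split: if_splits)
  qed
  moreover have "total_on (V \<times> W) ?R"
  proof (rule total_onI)
    fix a b assume ab: "a \<in> V \<times> W" "b \<in> V \<times> W" "a \<noteq> b"
    obtain x h y k where "a = (x, h)" "b = (y, k)"
      by (metis prod.collapse)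
    with ab show "(a, b) \<in> ?R \<or> (b, a) \<in> ?R"
      using tr(4) ts
      by (cases "h = k"; cases "h \<in> A")
        (auto simp: alternating_order_def spine_less_def total_on_def)
  qed
  moreover have "refl_on (V \<times> W) ?R" "?R \<subseteq> (V \<times> W) \<times> (V \<times> W)"
    using tr(3) by (auto simp: refl_on_def alternating_order_def)
  ultimately show ?thesis
    by (simp add: order_on_defs)
qed

lemma spine_less_alternating_orderD:
  assumes "spine_less (alternating_order V r A W s) (x, h) (y, k)"
  shows "spine_less s h k \<or> h = k \<and> (if h \<in> A then spine_less r x y else spine_less r y x)"
  using assms by (auto simp: spine_less_def alternating_order_def split: if_splits)

section \<open>Crossings and matching book embeddings in general\<close>

lemma crossing_sym: "crossing r e f \<Longrightarrow> crossing r f e"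
  unfolding crossing_def by blast

lemma crossingI:
  assumes "spine_less r a b" "spine_less r b c" "spine_less r c d"
  shows "crossing r {a, c} {b, d}"
  using assms unfolding crossing_def by blast

lemma crossingE:
  assumes "crossing r e f"
    and "\<And>a b c d. \<lbrakk>spine_less r a b; spine_less r b c; spine_less r c d;
           e = {a, c} \<and> f = {b, d} \<or> f = {a, c} \<and> e = {b, d}\<rbrakk> \<Longrightarrow> P"
  shows P
  using assms unfolding crossing_def by blast

lemma matching_book_embedding_edge_unique:
  assumes "matching_book_embedding G n r page" "simple_graph G"
    and "e \<in> edges G" "f \<in> edges G" "v \<in> e" "v \<in> f" "page e = page f"
  shows "e = f"
proof -
  let ?M = "{g \<in> edges G. v \<in> g \<and> page g = page e}"
  \<comment> \<open>Without finiteness the bound on \<open>card ?M\<close> would say nothing, since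
    infinite sets have cardinality 0.\<close>
  have "finite ?M"
    using simple_graph_finite_edges[OF assms(2)] by simp
  moreover have "card ?M \<le> 1"
    using assms unfolding matching_book_embedding_def simple_graph_def by blast
  ultimately show ?thesis
    using assms by (auto simp: card_le_Suc0_iff_eq)
qed

lemma matching_book_embedding_subgraph:
  assumes "matching_book_embedding G n r page" "finite (edges G)"
    and "verts G' = verts G" "edges G' \<subseteq> edges G"
  shows "matching_book_embedding G' n r page"
proof -
  have "card {e \<in> edges G'. v \<in> e \<and> page e = i} \<le> card {e \<in> edges G. v \<in> e \<and> page e = i}" for v i
    using assms by (intro card_mono) auto
  moreover have "card {e \<in> edges G. v \<in> e \<and> page e = i} \<le> 1" if "v \<in> verts G" "i < n" for v i
    using assms(1) that by (simp add: matching_book_embedding_def)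
  ultimately have "card {e \<in> edges G'. v \<in> e \<and> page e = i} \<le> 1" if "v \<in> verts G" "i < n" for v i
    using that order_trans by blast
  then show ?thesis
    using assms(1,3,4) unfolding matching_book_embedding_def by (simp add: subset_iff)
qed

lemma mbt_le: "matching_book_embedding G n r page \<Longrightarrow> mbt G \<le> n"
  unfolding mbt_def by (rule Least_le) blast

lemma mbt_attained:
  assumes "simple_graph G"
  obtains r page where "matching_book_embedding G (mbt G) r page"
  using LeastI_ex[OF matching_book_embedding_exists[OF assms]] unfolding mbt_def by blast

section \<open>Edges of the product and their crossings\<close>

lemma finite_edges_box_product:
  assumes "simple_graph K" "simple_graph H"
  shows "finite (edges (box_product K H))"
proof -
  have "edges (box_product K H) =
      (\<lambda>(E, h). E \<times> {h}) ` (edges K \<times> verts H) \<union> (\<lambda>(u, E). {u} \<times> E) ` (verts K \<times> edges H)"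
    by (auto simp: box_product_def)
  then show ?thesis
    using assms simple_graph_finite_edges[OF assms(1)] simple_graph_finite_edges[OF assms(2)]
    by (simp add: simple_graph_def)
qed

text \<open>Mediates between \<open>crossing\<close>, which lists the endpoints of an edge, and the
  product form of the edges in \<open>box_product\<close>.\<close>

lemma doubleton_cross_singleton:
  assumes "E \<times> {h} = {a, b}"
  shows "snd a = snd b" "E = {fst a, fst b}"
proof -
  have "a \<in> E \<times> {h}" "b \<in> E \<times> {h}"
    using assms by auto
  then show "snd a = snd b"
    by auto
  have "E = fst ` (E \<times> {h})"
    by simp
  then show "E = {fst a, fst b}"
    by (simp only: assms image_insert image_empty)
qed

lemma singleton_cross_doubleton:
  assumes "{u} \<times> E = {a, b}"
  shows "fst a = fst b" "E = {snd a, snd b}"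
proof -
  have "a \<in> {u} \<times> E" "b \<in> {u} \<times> E"
    using assms by auto
  then show "fst a = fst b"
    by auto
  have "E = snd ` ({u} \<times> E)"
    by simp
  then show "E = {snd a, snd b}"
    by (simp only: assms image_insert image_empty)
qed

text \<open>Every layer is an interval of the spine, so edges in different layers cannot alternate.
  Inside one layer the order is \<open>r\<close> or its converse, and reversing a spine preserves
  crossings.\<close>

lemma not_crossing_layers:
  assumes s: "linear_order_on W s" and nc: "\<not> crossing r E E'"
  shows "\<not> crossing (alternating_order V r A W s) (E \<times> {h}) (E' \<times> {h'})"
proof
  assume "crossing (alternating_order V r A W s) (E \<times> {h}) (E' \<times> {h'})"
  then obtain a b c d where less: "spine_less (alternating_order V r A W s) a b"
      "spine_less (alternating_order V r A W s) b c" "spine_less (alternating_order V r A W s) c d"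
    and ef: "E \<times> {h} = {a, c} \<and> E' \<times> {h'} = {b, d} \<or> E' \<times> {h'} = {a, c} \<and> E \<times> {h} = {b, d}"
    by (rule crossingE)
  have sn: "snd a = snd c" "snd b = snd d" and
    E: "E = {fst a, fst c} \<and> E' = {fst b, fst d} \<or> E' = {fst a, fst c} \<and> E = {fst b, fst d}"
    using doubleton_cross_singleton[of E h a c] doubleton_cross_singleton[of E h b d]
      doubleton_cross_singleton[of E' h' a c] doubleton_cross_singleton[of E' h' b d] ef by metis+
  obtain x y z w k k' where abcd: "a = (x, k)" "c = (z, k)" "b = (y, k')" "d = (w, k')"
    using sn by (metis prod.collapse)
  \<comment> \<open>Along \<open>a\<close>, \<open>b\<close>, \<open>c\<close>, \<open>d\<close> the
    layers read \<open>k\<close>, \<open>k'\<close>, \<open>k\<close>, \<open>k'\<close> and never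
    decrease in \<open>s\<close>.\<close>
  have "k = k'"
    using less spine_less_asym[OF s] unfolding abcd
    by (auto dest!: spine_less_alternating_orderD)
  then have "if k \<in> A then spine_less r x y \<and> spine_less r y z \<and> spine_less r z w
     else spine_less r w z \<and> spine_less r z y \<and> spine_less r y x"
    using less spine_less_asym[OF s] unfolding abcd
    by (auto simp: spine_less_def[of s] dest!: spine_less_alternating_orderD split: if_splits)
  \<comment> \<open>In a reversed layer the four points are read backwards as \<open>w\<close>,
    \<open>z\<close>, \<open>y\<close>, \<open>x\<close>; the same two pairs still
    alternate.\<close>
  then have "crossing r {x, z} {y, w}"
    using crossingI[of r x y z w] crossingI[of r w z y x]
    by (auto simp: insert_commute split: if_splits intro: crossing_sym)
  then show False
    using nc E crossing_sym unfolding abcd by fastforce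
qed

text \<open>If \<open>E\<close> and \<open>E'\<close> are disjoint, the four endpoints lie in
  distinct layers and a crossing would project to one in \<open>s\<close>. If they are equal,
  exactly one of the two end layers is reversed, by \<open>card (E \<inter> A) = 1\<close>, so the
  copies are nested.\<close>

lemma not_crossing_fibres:
  assumes r: "linear_order_on V r" and s: "linear_order_on W s"
    and E: "card E = 2" "card (E \<inter> A) = 1" and nc: "\<not> crossing s E E'"
    and disj: "E = E' \<or> E \<inter> E' = {}"
  shows "\<not> crossing (alternating_order V r A W s) ({u} \<times> E) ({u'} \<times> E')"
proof
  assume "crossing (alternating_order V r A W s) ({u} \<times> E) ({u'} \<times> E')"
  then obtain a b c d where less: "spine_less (alternating_order V r A W s) a b"
      "spine_less (alternating_order V r A W s) b c" "spine_less (alternating_order V r A W s) c d"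
    and ef: "{u} \<times> E = {a, c} \<and> {u'} \<times> E' = {b, d} \<or> {u'} \<times> E' = {a, c} \<and> {u} \<times> E = {b, d}"
    by (rule crossingE)
  have fs: "fst a = fst c" "fst b = fst d" and
    EE: "E = {snd a, snd c} \<and> E' = {snd b, snd d} \<or> E' = {snd a, snd c} \<and> E = {snd b, snd d}"
    using singleton_cross_doubleton[of u E a c] singleton_cross_doubleton[of u E b d]
      singleton_cross_doubleton[of u' E' a c] singleton_cross_doubleton[of u' E' b d] ef by metis+
  obtain x y h k l m where abcd: "a = (x, h)" "c = (x, l)" "b = (y, k)" "d = (y, m)"
    using fs by (metis prod.collapse)
  have E': "E = {h, l} \<and> E' = {k, m} \<or> E' = {h, l} \<and> E = {k, m}"
    using EE by (simp add: abcd)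
  have le: "spine_less s h k \<or> h = k" "spine_less s k l \<or> k = l" "spine_less s l m \<or> l = m"
    using less unfolding abcd by (auto dest!: spine_less_alternating_orderD)
  from disj show False
  proof
    assume "E = E'"
    then have hl: "{h, l} = E" "{k, m} = E"
      using E' by auto
    then have "h \<noteq> l" "k \<noteq> m"
      using E(1) by auto
    \<comment> \<open>The layers satisfy \<open>h \<le> k \<le> l \<le> m\<close> in
      \<open>s\<close>. The other matching of the two pairs, \<open>h = m\<close> and
      \<open>k = l\<close>, would collapse all four and contradict
      \<open>h \<noteq> l\<close>.\<close>
    then have hk: "h = k" "l = m"
      using hl le spine_less_asym[OF s] spine_less_trans[OF s] by (metis doubleton_eq_iff)+
    \<comment> \<open>A crossing puts the endpoint over \<open>x\<close> before the one over
      \<open>y\<close> in both layers \<open>h\<close> and \<open>l\<close>. As just one of these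
      layers is reversed, \<open>x\<close> and \<open>y\<close> would be ordered both ways in
      \<open>r\<close>.\<close>
    have "h \<in> A \<longleftrightarrow> l \<notin> A"
      using E(2) hl(1)[symmetric] \<open>h \<noteq> l\<close> by (auto simp: Int_insert_left split: if_splits)
    moreover have "if h \<in> A then spine_less r x y else spine_less r y x"
      using spine_less_alternating_orderD[OF less(1)[unfolded abcd]] hk
      by (auto simp: spine_less_def[of s])
    moreover have "if l \<in> A then spine_less r x y else spine_less r y x"
      using spine_less_alternating_orderD[OF less(3)[unfolded abcd]] hk
      by (auto simp: spine_less_def[of s])
    ultimately show False
      using spine_less_asym[OF r] by (auto split: if_splits)
  next
    assume "E \<inter> E' = {}"
    then have "h \<noteq> k" "k \<noteq> l" "l \<noteq> m"
      using E' by auto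
    then have "crossing s {h, l} {k, m}"
      using le by (auto intro: crossingI)
    then show False
      using nc E' crossing_sym by fastforce
  qed
qed

section \<open>The embedding of the product and of the F-sum\<close>

lemma matching_book_embedding_box_product:
  assumes K: "simple_graph K" "matching_book_embedding K n r p"
    and H: "simple_graph H" "matching_book_embedding H m s q"
    and "bipartite H"
  shows "\<exists>t page. matching_book_embedding (box_product K H) (n + m) t page"
proof -
  obtain A B where AB: "A \<inter> B = {}" "\<forall>e\<in>edges H. \<exists>a\<in>A. \<exists>b\<in>B. e = {a, b}"
    using \<open>bipartite H\<close> unfolding bipartite_def by (elim exE conjE)
  have r: "linear_order_on (verts K) r" and s: "linear_order_on (verts H) s"
    using K H by (auto simp: matching_book_embedding_def)
  define R where "R = alternating_order (verts K) r A (verts H) s"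
  define page where "page = product_page n p q"
  have cK: "card E = 2" and pK: "p E < n" if "E \<in> edges K" for E
    using K that by (auto simp: simple_graph_def matching_book_embedding_def)
  have cH: "card E = 2" and pH: "q E < m" if "E \<in> edges H" for E
    using H that by (auto simp: simple_graph_def matching_book_embedding_def)
  \<comment> \<open>Bipartiteness in the form used for nesting: each edge of \<open>H\<close> joins
    a layer in forward order to a reversed one.\<close>
  have HA: "card (E \<inter> A) = 1" if E: "E \<in> edges H" for E
  proof -
    obtain a b where "a \<in> A" "b \<in> B" "E = {a, b}"
      using AB(2) E by blast
    moreover from this have "b \<notin> A"
      using AB(1) by blast
    ultimately show ?thesis
      by (simp add: Int_insert_left)
  qed
  have ncK: "\<not> crossing r E E'" if "E \<in> edges K" "E' \<in> edges K" "p E = p E'" for E E'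
    using K(2) that by (simp add: matching_book_embedding_def)
  have ncH: "\<not> crossing s E E'" if "E \<in> edges H" "E' \<in> edges H" "q E = q E'" for E E'
    using H(2) that by (simp add: matching_book_embedding_def)
  have page_layer: "page (E \<times> {h}) = p E" if "E \<in> edges K" for E h
  proof -
    \<comment> \<open>For empty \<open>E\<close> the second projection of
      \<open>E \<times> {h}\<close> would be empty rather than \<open>{h}\<close>.\<close>
    have "E \<noteq> {}" using cK[OF that] by auto
    then show ?thesis by (simp add: page_def product_page_def)
  qed
  have page_fibre: "page ({u} \<times> E) = n + q E" if "E \<in> edges H" for u E
    using cH[OF that] by (simp add: page_def product_page_def)
  have edge_cases: thesis
    if e: "e \<in> edges (box_product K H)"
      and "\<And>E h. \<lbrakk>e = E \<times> {h}; E \<in> edges K; page e = p E\<rbrakk> \<Longrightarrow> thesis"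
      and "\<And>u E. \<lbrakk>e = {u} \<times> E; E \<in> edges H; page e = n + q E\<rbrakk> \<Longrightarrow> thesis" for e thesis
  proof -
    consider E h where "e = E \<times> {h}" "E \<in> edges K" | u E where "e = {u} \<times> E" "E \<in> edges H"
      using e unfolding box_product_def by auto
    then show thesis
      by cases (use that(2,3) page_layer page_fibre in simp_all)
  qed
  \<comment> \<open>Copies of edges of \<open>K\<close> use pages below \<open>n\<close>, copies of
    edges of \<open>H\<close> pages from \<open>n\<close> on. Hence edges on a common page come from
    the same factor and share a page there, which reduces both the crossing and the matching
    condition to that factor.\<close>
  have same_page: thesis
    if e: "e \<in> edges (box_product K H)" and f: "f \<in> edges (box_product K H)"
      and eq: "page e = page f"
      and layers: "\<And>E E' h h'. \<lbrakk>e = E \<times> {h}; f = E' \<times> {h'}; E \<in> edges K; E' \<in> edges K; p E = p E'\<rbrakk>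
        \<Longrightarrow> thesis"
      and fibres: "\<And>E E' u u'. \<lbrakk>e = {u} \<times> E; f = {u'} \<times> E'; E \<in> edges H; E' \<in> edges H; q E = q E'\<rbrakk>
        \<Longrightarrow> thesis" for e f thesis
  proof (rule edge_cases[OF e]; rule edge_cases[OF f])
    fix E E' h h'
    assume "e = E \<times> {h}" "E \<in> edges K" "page e = p E" "f = E' \<times> {h'}" "E' \<in> edges K" "page f = p E'"
    then show thesis
      using layers eq by simp
  next
    fix E E' h u
    assume "E \<in> edges K" "page e = p E" "page f = n + q E'"
    then show thesis
      using pK[of E] eq by simp
  next
    fix E E' h u
    assume "E' \<in> edges K" "page e = n + q E" "page f = p E'"
    then show thesis
      using pK[of E'] eq by simp
  next
    fix E E' u u'
    assume "e = {u} \<times> E" "E \<in> edges H" "page e = n + q E"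
      "f = {u'} \<times> E'" "E' \<in> edges H" "page f = n + q E'"
    then show thesis
      using fibres eq by simp
  qed
  have "linear_order_on (verts (box_product K H)) R"
    using linear_order_alternating_order[OF r s] by (simp add: R_def box_product_def)
  moreover have "page e < n + m" if "e \<in> edges (box_product K H)" for e
    by (rule edge_cases[OF that]) (simp_all add: pH trans_less_add1 pK)
  moreover have "\<not> crossing R e f"
    if "e \<in> edges (box_product K H)" "f \<in> edges (box_product K H)" "page e = page f" for e f
  proof (rule same_page[OF that])
    fix E E' h h'
    assume "e = E \<times> {h}" "f = E' \<times> {h'}" "E \<in> edges K" "E' \<in> edges K" "p E = p E'"
    then show ?thesis
      unfolding R_def using not_crossing_layers[OF s ncK] by blast
  next
    fix E E' u u'
    assume *: "e = {u} \<times> E" "f = {u'} \<times> E'" "E \<in> edges H" "E' \<in> edges H" "q E = q E'"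
    \<comment> \<open>The matching condition in \<open>H\<close>: edges on one page that share a
      vertex coincide.\<close>
    then have "E = E' \<or> E \<inter> E' = {}"
      using matching_book_embedding_edge_unique[OF H(2,1)] by blast
    then show ?thesis
      unfolding R_def using * not_crossing_fibres[OF r s cH HA ncH] by blast
  qed
  moreover have "card {e \<in> edges (box_product K H). v \<in> e \<and> page e = i} \<le> 1" (is "card ?M \<le> 1") for v i
  proof -
    have "e = f" if "e \<in> ?M" "f \<in> ?M" for e f
    proof -
      have ef: "e \<in> edges (box_product K H)" "f \<in> edges (box_product K H)" "page e = page f"
        and v: "v \<in> e" "v \<in> f"
        using that by auto
      show ?thesis
      proof (rule same_page[OF ef])
        fix E E' h h'
        assume *: "e = E \<times> {h}" "f = E' \<times> {h'}" "E \<in> edges K" "E' \<in> edges K" "p E = p E'"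
        \<comment> \<open>The common vertex \<open>v\<close> fixes the layer and projects to a
          common endpoint, so the matching condition in \<open>K\<close> identifies \<open>E\<close>
          and \<open>E'\<close>.\<close>
        then have "fst v \<in> E" "fst v \<in> E'" "h = h'"
          using v by auto
        then show ?thesis
          using matching_book_embedding_edge_unique[OF K(2,1)] * by blast
      next
        fix E E' u u'
        assume *: "e = {u} \<times> E" "f = {u'} \<times> E'" "E \<in> edges H" "E' \<in> edges H" "q E = q E'"
        then have "snd v \<in> E" "snd v \<in> E'" "u = u'"
          using v by auto
        then show ?thesis
          using matching_book_embedding_edge_unique[OF H(2,1)] * by blast
      qed
    qed
    moreover have "finite ?M"
      using finite_edges_box_product[OF K(1) H(1)] by simp
    ultimately show ?thesis
      by (simp only: One_nat_def card_le_Suc0_iff_eq) blast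
  qed
  ultimately have "matching_book_embedding (box_product K H) (n + m) R page"
    by (auto simp: matching_book_embedding_def)
  then show ?thesis by blast
qed

text \<open>The layers of both graphs agree. The F-sum has copies of \<open>H\<close> only over
  original vertices \<open>Inl u\<close>, the product over the new vertices \<open>Inr e\<close> as
  well.\<close>

lemma F_sum_subgraph_box_product:
  assumes "verts (F G) = verts G <+> edges G"
  shows "verts (F_sum F G H) = verts (box_product (F G) H)"
    and "edges (F_sum F G H) \<subseteq> edges (box_product (F G) H)"
proof -
  show "verts (F_sum F G H) = verts (box_product (F G) H)"
    using assms by (simp add: F_sum_def box_product_def)
  show "edges (F_sum F G H) \<subseteq> edges (box_product (F G) H)"
  proof
    fix e assume "e \<in> edges (F_sum F G H)"
    then consider
      (fibre) u h k where "e = {(Inl u, h), (Inl u, k)}" "u \<in> verts G" "{h, k} \<in> edges H"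
    | (layer) x y h where "e = {(x, h), (y, h)}" "h \<in> verts H" "{x, y} \<in> edges (F G)"
      by (auto simp: F_sum_def)
    then show "e \<in> edges (box_product (F G) H)"
    proof cases
      case fibre
      then have "e = {Inl u} \<times> {h, k}" "Inl u \<in> verts (F G)"
        using assms by auto
      then show ?thesis
        using fibre(3) unfolding box_product_def by auto
    next
      case layer
      then have "e = {x, y} \<times> {h}"
        by auto
      then show ?thesis
        using layer(2,3) unfolding box_product_def by auto
    qed
  qed
qed

theorem theorem3p2:
  fixes G :: "'a sgraph" and H :: "'b sgraph"
    and F :: "'a sgraph \<Rightarrow> ('a + 'a set) sgraph"
  assumes "F \<in> {S_graph, Q_graph, R_graph, T_graph}"
    and "simple_graph G"
    and "simple_graph H" and "bipartite H" and "dispersable H"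
  shows "mbt (F_sum F G H) \<le> mbt (F G) + max_degree H"
proof -
  have FG: "simple_graph (F G)"
    using simple_graph_F assms by blast
  have V: "verts (F G) = verts G <+> edges G"
    using assms(1) by (auto simp: S_graph_def Q_graph_def R_graph_def T_graph_def)
  obtain r p where "matching_book_embedding (F G) (mbt (F G)) r p"
    using mbt_attained[OF FG] .
  moreover obtain s q where "matching_book_embedding H (mbt H) s q"
    using mbt_attained[OF assms(3)] .
  ultimately obtain t page
    where "matching_book_embedding (box_product (F G) H) (mbt (F G) + mbt H) t page"
    using matching_book_embedding_box_product FG assms(3,4) by blast
  then have "matching_book_embedding (F_sum F G H) (mbt (F G) + mbt H) t page"
    by (rule matching_book_embedding_subgraph[OF _ finite_edges_box_product[OF FG assms(3)]
          F_sum_subgraph_box_product[of F G H, OF V]])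
  \<comment> \<open>Dispersability replaces \<open>mbt H\<close> by
    \<open>max_degree H\<close>.\<close>
  then show ?thesis
    using mbt_le assms(5) by (fastforce simp: dispersable_def)
qed

end
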